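(* Let $n>1$ and consider a zip tree with $n$ nodes whose ranks are independent random variables, each geometric with mean $1$ (rank $j\in\{0,1,2,\dots\}$ with probability $1/2^{j+1}$), independent of the keys. Then for a node $x$ of rank $k$ (i.e., conditioned on $x.\mathit{rank}=k$), the expected number of descendants of $x$ (including $x$ itself) is at most $3\cdot 2^k-1$. The expected number of descendants of an arbitrary node is at most $(3/2)\lg n+3$.
   Context: A zip tree is a binary search tree (distinct keys in symmetric order: left-subtree keys smaller, right-subtree keys larger) in which each node has a numeric rank and the parent of a node has rank strictly greater than that of its left child and greater than or equal to that of its right child. The descendants of a node are the nodes of its subtree, including itself. $\lg$ denotes the base-$2$ logarithm. *)

theory Defs
  imports "HOL-Probability.Probability" "HOL-Library.Tree"
begin

text \<open>
  The keys of a binary search tree are distinct, so every node is identified with its key, and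
  the ranks are a function of the key.
\<close>

definition zip_tree :: "('a::linorder \<Rightarrow> 'b::linorder) \<Rightarrow> 'a tree \<Rightarrow> bool" where
  "zip_tree rk t \<longleftrightarrow>
     bst t \<and>
     (\<forall>l x r. \<langle>l, x, r\<rangle> \<in> subtrees t \<longrightarrow>
        (l \<noteq> \<langle>\<rangle> \<longrightarrow> rk (value l) < rk x) \<and>
        (r \<noteq> \<langle>\<rangle> \<longrightarrow> rk (value r) \<le> rk x))"

definition descendants :: "'a tree \<Rightarrow> 'a \<Rightarrow> 'a set" where
  "descendants t x = {y. \<exists>l r. \<langle>l, x, r\<rangle> \<in> subtrees t \<and> y \<in> set_tree \<langle>l, x, r\<rangle>}"

text \<open>Every finite set of keys with every rank assignment carries a zip tree.\<close>

lemma zip_tree_exists: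
  fixes rk :: "'a::linorder \<Rightarrow> 'b::linorder"
  assumes "finite K"
  shows "\<exists>t. zip_tree rk t \<and> set_tree t = K"
  using assms
proof (induction K rule: finite_psubset_induct)
  case (psubset K)
  show ?case
  proof (cases "K = {}")
    case True
    then show ?thesis
      by (intro exI[of _ "\<langle>\<rangle>"]) (simp add: zip_tree_def)
  next
    case False
    define M where "M = {x \<in> K. rk x = Max (rk ` K)}"
    define x where "x = Min M"
    have "Max (rk ` K) \<in> rk ` K"
      using psubset.hyps False by (intro Max_in) auto
    then obtain z where "z \<in> K" "rk z = Max (rk ` K)"
      by (metis imageE)
    then have fin: "finite M" and ne: "M \<noteq> {}"
      using psubset.hyps by (auto simp: M_def)
    have xM: "x \<in> M" unfolding x_def using fin ne by (rule Min_in)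
    then have xK: "x \<in> K" and rx: "rk x = Max (rk ` K)" by (auto simp: M_def)
    have le: "rk y \<le> rk x" if "y \<in> K" for y
      using that psubset.hyps rx by simp
    have lt: "rk y < rk x" if "y \<in> K" "y < x" for y
    proof -
      have "y \<notin> M" using that fin Min_le[of M y] unfolding x_def by (metis leD)
      then show ?thesis using that(1) le[of y] rx unfolding M_def by force
    qed
    obtain l where l: "zip_tree rk l" "set_tree l = {y \<in> K. y < x}"
      using psubset.IH[of "{y \<in> K. y < x}"] xK by auto
    obtain r where r: "zip_tree rk r" "set_tree r = {y \<in> K. x < y}"
      using psubset.IH[of "{y \<in> K. x < y}"] xK by auto
    have val: "value t \<in> set_tree t" if "t \<noteq> \<langle>\<rangle>" for t :: "'a tree"
      using that by (cases t) auto
    have "rk (value l) < rk x" if "l \<noteq> \<langle>\<rangle>"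
      using val[OF that] lt[of "value l"] unfolding l(2) by blast
    moreover have "rk (value r) \<le> rk x" if "r \<noteq> \<langle>\<rangle>"
      using val[OF that] le[of "value r"] unfolding r(2) by blast
    moreover have "bst \<langle>l, x, r\<rangle>"
      using l r by (simp add: zip_tree_def)
    ultimately have "zip_tree rk \<langle>l, x, r\<rangle>"
      using l(1) r(1) unfolding zip_tree_def subtrees.simps by blast
    moreover have "set_tree \<langle>l, x, r\<rangle> = K"
      unfolding tree.set l(2) r(2) using xK by (auto simp: not_less_iff_gr_or_eq)
    ultimately show ?thesis by blast
  qed
qed

end

theory Submission imports Defs begin

text \<open>
  A key \<open>y > x\<close> is a descendant of \<open>x\<close> iff no key in \<open>(x, y]\<close> has rank above that of \<open>x\<close>, and a
  key \<open>y < x\<close> is one iff all keys in \<open>[y, x)\<close> have rank below that of \<open>x\<close>. Given that \<open>x\<close> has rank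
  \<open>k\<close>, these events have probability \<open>(1 - 1/2^(k+1))^j\<close> and \<open>(1 - 1/2^k)^j\<close> for the \<open>j\<close>-th
  successor and predecessor, and the geometric series are bounded by \<open>2^(k+1) - 1\<close> and \<open>2^k - 1\<close>.
  For the unconditional bound, choose \<open>m\<close> with \<open>n \<le> 2^m \<le> 2n\<close>; ranks below \<open>m\<close> contribute at most
  \<open>3/2\<close> each, and the remaining ranks, having total probability \<open>1/2^m\<close>, at most \<open>n/2^m\<close>.
\<close>

section \<open>Descendants in a zip tree, described by keys and ranks\<close>

lemma zip_tree_NodeD:
  assumes "zip_tree rk \<langle>l, v, r\<rangle>"
  shows "zip_tree rk l" "zip_tree rk r"
    "\<And>y. y \<in> set_tree l \<Longrightarrow> y < v" "\<And>y. y \<in> set_tree r \<Longrightarrow> v < y"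
    "l \<noteq> \<langle>\<rangle> \<Longrightarrow> rk (value l) < rk v" "r \<noteq> \<langle>\<rangle> \<Longrightarrow> rk (value r) \<le> rk v"
  using assms unfolding zip_tree_def by auto

text \<open>Ranks never increase from parent to child. This turns the local condition of a zip tree
  into a global one on subtrees.\<close>

lemma zip_tree_rank_le_root:
  "zip_tree rk t \<Longrightarrow> y \<in> set_tree t \<Longrightarrow> rk y \<le> rk (value t)"
proof (induction t)
  case (Node l v r)
  note D = zip_tree_NodeD[OF Node.prems(1)]
  consider "y = v" | "y \<in> set_tree l" | "y \<in> set_tree r" using Node.prems(2) by auto
  then show ?case
  proof cases
    case 2
    then have "l \<noteq> \<langle>\<rangle>" by auto
    with Node.IH(1)[OF D(1) 2] D(5) show ?thesis by simp
  next
    case 3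
    then have "r \<noteq> \<langle>\<rangle>" by auto
    with Node.IH(2)[OF D(2) 3] D(6) show ?thesis by simp
  qed simp
qed simp

lemma descendants_Leaf [simp]: "descendants \<langle>\<rangle> x = {}"
  by (simp add: descendants_def)

lemma descendants_Node:
  "descendants \<langle>l, v, r\<rangle> x =
     (if x = v then set_tree \<langle>l, v, r\<rangle> else {}) \<union> descendants l x \<union> descendants r x"
  unfolding descendants_def by auto

lemma descendants_subset: "descendants t x \<subseteq> set_tree t"
  by (induction t) (auto simp: descendants_Node)

lemma descendants_not_in: "x \<notin> set_tree t \<Longrightarrow> descendants t x = {}"
  by (induction t) (auto simp: descendants_Node)

text \<open>If \<open>x\<close> is the root, its rank dominates all others, strictly on the left, so
  both conditions always hold. Otherwise the root \<open>v\<close> outranks \<open>x\<close>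
  (strictly if \<open>x\<close> lies to its left, weakly if to its right) and thereby blocks exactly
  the keys outside the subtree containing \<open>x\<close>. Inside that subtree induction applies.
  The right-hand side mentions the tree only through its set of keys.\<close>

lemma zip_tree_descendants:
  assumes "zip_tree rk t" "x \<in> set_tree t"
  shows "descendants t x =
    {y \<in> set_tree t. (\<forall>z\<in>set_tree t. x < z \<and> z \<le> y \<longrightarrow> rk z \<le> rk x) \<and>
                     (\<forall>z\<in>set_tree t. y \<le> z \<and> z < x \<longrightarrow> rk z < rk x)}"
  using assms
proof (induction t)
  case (Node l v r)
  note D = zip_tree_NodeD[OF Node.prems(1)]
  have L: "rk y < rk v" if "y \<in> set_tree l" for y
  proof -
    have "l \<noteq> \<langle>\<rangle>" using that by auto
    then show ?thesis using zip_tree_rank_le_root[OF D(1) that] D(5) by simp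
  qed
  have R: "rk y \<le> rk v" if "y \<in> set_tree r" for y
  proof -
    have "r \<noteq> \<langle>\<rangle>" using that by auto
    then show ?thesis using zip_tree_rank_le_root[OF D(2) that] D(6) by simp
  qed
  consider "x = v" | "x \<in> set_tree l" | "x \<in> set_tree r" using Node.prems(2) by auto
  then show ?case
  proof cases
    case 1
    then have "descendants \<langle>l, v, r\<rangle> x = set_tree \<langle>l, v, r\<rangle>"
      using descendants_subset[of l v] descendants_subset[of r v]
      by (auto simp: descendants_Node)
    moreover have "rk z \<le> rk x" if "z \<in> set_tree \<langle>l, v, r\<rangle>" "x < z" for z
      using that 1 R D(3)[of z] by auto
    moreover have "rk z < rk x" if "z \<in> set_tree \<langle>l, v, r\<rangle>" "z < x" for z
      using that 1 L D(4)[of z] by auto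
    ultimately show ?thesis by blast
  next
    case 2
    then have "descendants \<langle>l, v, r\<rangle> x = descendants l x"
      using D(3)[of x] D(4)[of x]
      by (cases "x \<in> set_tree l"; cases "x \<in> set_tree r")
        (auto simp: descendants_Node descendants_not_in)
    also have "\<dots> = {y \<in> set_tree \<langle>l, v, r\<rangle>.
        (\<forall>z\<in>set_tree \<langle>l, v, r\<rangle>. x < z \<and> z \<le> y \<longrightarrow> rk z \<le> rk x) \<and>
        (\<forall>z\<in>set_tree \<langle>l, v, r\<rangle>. y \<le> z \<and> z < x \<longrightarrow> rk z < rk x)}" (is "_ = ?S")
    proof -
      \<comment> \<open>Any \<open>y\<close> outside \<open>l\<close> has \<open>v\<close> in (x,
        y], and the rank of \<open>v\<close> is too high.\<close>
      have "y \<in> set_tree l" if "y \<in> ?S" for y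
      proof (rule ccontr)
        assume "y \<notin> set_tree l"
        then have "v \<le> y" using that D(4)[of y] by auto
        then have "rk v \<le> rk x" using that D(3)[OF 2] by simp
        then show False using L[OF 2] by simp
      qed
      \<comment> \<open>Enlarging the range of \<open>z\<close> from \<open>l\<close> to the whole
        tree adds no constraint: this fact and the next are vacuous, since the added
        \<open>z\<close> lie above both \<open>x\<close> and \<open>y\<close>.\<close>
      moreover have "rk z \<le> rk x"
        if "y \<in> set_tree l" "z = v \<or> z \<in> set_tree r" "z \<le> y" for y z
        using that D(3)[of y] D(4)[of z] by auto
      moreover have "rk z < rk x"
        if "z = v \<or> z \<in> set_tree r" "z < x" for z
        using that D(3)[of x] D(4)[of z] 2 by auto
      ultimately show ?thesis unfolding Node.IH(1)[OF D(1) 2] by auto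
    qed
    finally show ?thesis .
  next
    case 3
    then have "descendants \<langle>l, v, r\<rangle> x = descendants r x"
      using D(3)[of x] D(4)[of x]
      by (cases "x \<in> set_tree l"; cases "x \<in> set_tree r")
        (auto simp: descendants_Node descendants_not_in)
    also have "\<dots> = {y \<in> set_tree \<langle>l, v, r\<rangle>.
        (\<forall>z\<in>set_tree \<langle>l, v, r\<rangle>. x < z \<and> z \<le> y \<longrightarrow> rk z \<le> rk x) \<and>
        (\<forall>z\<in>set_tree \<langle>l, v, r\<rangle>. y \<le> z \<and> z < x \<longrightarrow> rk z < rk x)}" (is "_ = ?S")
    proof -
      \<comment> \<open>Here \<open>v\<close> lies in [y, x), where ranks must be strictly below
        that of \<open>x\<close>; a tie with \<open>v\<close> already blocks
        \<open>y\<close>.\<close>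
      have "y \<in> set_tree r" if "y \<in> ?S" for y
      proof (rule ccontr)
        assume "y \<notin> set_tree r"
        then have "y \<le> v" using that D(3)[of y] by auto
        then have "rk v < rk x" using that D(4)[OF 3] by simp
        then show False using R[OF 3] by simp
      qed
      moreover have "rk z < rk x"
        if "y \<in> set_tree r" "z = v \<or> z \<in> set_tree l" "y \<le> z" for y z
        using that D(4)[of y] D(3)[of z] by auto
      moreover have "rk z \<le> rk x"
        if "z = v \<or> z \<in> set_tree l" "x < z" for z
        using that D(4)[of x] D(3)[of z] 3 by auto
      ultimately show ?thesis unfolding Node.IH(2)[OF D(2) 3] by auto
    qed
    finally show ?thesis .
  qed
qed simp

section \<open>Geometric sums over a finite linear order\<close>

lemma sum_power_card_le:
  fixes S :: "'a::linorder set" and q :: real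
  assumes "finite S"
  shows "(\<Sum>y\<in>S. q ^ card {z \<in> S. z \<le> y}) = (\<Sum>j=1..card S. q ^ j)"
  using assms
proof (induction S rule: finite_linorder_max_induct)
  case (insert b A)
  \<comment> \<open>Adding a new maximum leaves the old exponents alone and contributes the top
    power.\<close>
  have "{z \<in> insert b A. z \<le> y} = {z \<in> A. z \<le> y}" if "y \<in> A" for y
    using that insert by auto
  moreover have "{z \<in> insert b A. z \<le> b} = insert b A" using insert by auto
  moreover have "b \<notin> A" using insert by auto
  ultimately show ?case using insert by simp
qed simp

lemma sum_power_card_ge:
  fixes S :: "'a::linorder set" and q :: real
  assumes "finite S"
  shows "(\<Sum>y\<in>S. q ^ card {z \<in> S. y \<le> z}) = (\<Sum>j=1..card S. q ^ j)"
  using assms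
proof (induction S rule: finite_linorder_min_induct)
  case (insert b A)
  have "{z \<in> insert b A. y \<le> z} = {z \<in> A. y \<le> z}" if "y \<in> A" for y
    using that insert by auto
  moreover have "{z \<in> insert b A. b \<le> z} = insert b A" using insert by auto
  moreover have "b \<notin> A" using insert by auto
  ultimately show ?case using insert by simp
qed simp

text \<open>With q = 1 - 1/a the full series has value q/(1 - q) = a - 1, and the partial sum is (a
  - 1)(1 - q^N). The case a = 1 gives q = 0 and is needed for the left side of a node of rank
  0.\<close>

lemma sum_geometric_le:
  fixes a :: real
  assumes "a \<ge> 1"
  shows "(\<Sum>j=1..N. (1 - 1 / a) ^ j) \<le> a - 1"
proof -
  define q where "q = 1 - 1 / a"
  have q: "0 \<le> q" "q = a * q - (a - 1) * q" "a * q = a - 1"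
    using assms by (auto simp: q_def field_simps)
  have "(\<Sum>j=1..N. q ^ j) = (a - 1) * (1 - q ^ N)"
  proof (induction N)
    case (Suc N)
    have "(a - 1) * q = (a - 1) - q" using q by simp
    then have "(a - 1) * (q * q ^ N) = ((a - 1) - q) * q ^ N"
      by (simp only: mult.assoc[symmetric])
    with Suc show ?case by (simp add: algebra_simps)
  qed simp
  also have "\<dots> \<le> (a - 1) * 1"
    using assms q(1) by (intro mult_left_mono) simp_all
  finally show ?thesis by (simp add: q_def)
qed

text \<open>The sum splits at \<open>x\<close>: the key itself gives 1, the larger keys at most
  2^(k+1) - 1, the smaller ones at most 2^k - 1.\<close>

lemma sum_descendant_prob_le:
  fixes K :: "'a::linorder set"
  assumes "finite K" "x \<in> K"
  shows "(\<Sum>y\<in>K. (1 - 1 / 2 ^ Suc k) ^ card {z \<in> K. x < z \<and> z \<le> y} *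
                  (1 - 1 / 2 ^ k) ^ card {z \<in> K. y \<le> z \<and> z < x}) \<le> (3 * 2 ^ k - 1 :: real)"
    (is "sum ?f K \<le> _")
proof -
  let ?A = "{y \<in> K. x < y}" and ?B = "{y \<in> K. y < x}"
  have "sum ?f K = sum ?f (insert x (?A \<union> ?B))"
    using assms(2) by (intro sum.cong) auto
  also have "\<dots> = ?f x + sum ?f (?A \<union> ?B)"
    using assms(1) by (intro sum.insert) simp_all
  also have "sum ?f (?A \<union> ?B) = sum ?f ?A + sum ?f ?B"
    using assms(1) by (intro sum.union_disjoint) auto
  also have "?f x = 1"
  proof -
    have "{z \<in> K. x < z \<and> z \<le> x} = {}" "{z \<in> K. x \<le> z \<and> z < x} = {}" by auto
    then show ?thesis by (simp only: card.empty power_0 mult_1)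
  qed
  also have "sum ?f ?A = (\<Sum>y\<in>?A. (1 - 1 / 2 ^ Suc k) ^ card {z \<in> ?A. z \<le> y})"
  \<comment> \<open>For keys above \<open>x\<close> the second exponent counts the empty set, so
    only the first factor survives; below \<open>x\<close> it is the other way round.\<close>
  proof (rule sum.cong)
    fix y assume "y \<in> ?A"
    then have "{z \<in> K. y \<le> z \<and> z < x} = {}" by auto
    moreover have "{z \<in> K. x < z \<and> z \<le> y} = {z \<in> ?A. z \<le> y}" by auto
    ultimately show "?f y = (1 - 1 / 2 ^ Suc k) ^ card {z \<in> ?A. z \<le> y}"
      by (simp only: card.empty power_0 mult_1_right)
  qed simp
  also have "\<dots> = (\<Sum>j=1..card ?A. (1 - 1 / 2 ^ Suc k) ^ j)"
    using assms(1) by (intro sum_power_card_le) simp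
  also have "sum ?f ?B = (\<Sum>y\<in>?B. (1 - 1 / 2 ^ k) ^ card {z \<in> ?B. y \<le> z})"
  proof (rule sum.cong)
    fix y assume "y \<in> ?B"
    then have "{z \<in> K. x < z \<and> z \<le> y} = {}" by auto
    moreover have "{z \<in> K. y \<le> z \<and> z < x} = {z \<in> ?B. y \<le> z}" by auto
    ultimately show "?f y = (1 - 1 / 2 ^ k) ^ card {z \<in> ?B. y \<le> z}"
      by (simp only: card.empty power_0 mult_1)
  qed simp
  also have "\<dots> = (\<Sum>j=1..card ?B. (1 - 1 / 2 ^ k) ^ j)"
    using assms(1) by (intro sum_power_card_ge) simp
  also have "1 + ((\<Sum>j=1..card ?A. (1 - 1 / 2 ^ Suc k) ^ j) + (\<Sum>j=1..card ?B. (1 - 1 / 2 ^ k) ^ j))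
      \<le> 1 + ((2 ^ Suc k - 1) + (2 ^ k - 1) :: real)"
    by (intro add_left_mono add_mono sum_geometric_le one_le_power) simp_all
  finally show ?thesis by simp
qed

section \<open>Geometric ranks and the events they determine\<close>

lemma prob_geometric_half_lessThan:
  "measure_pmf.prob (geometric_pmf (1/2)) {..<m} = 1 - 1 / 2 ^ m"
  by (subst measure_measure_pmf_finite, simp, induction m)
    (simp_all add: field_simps power_one_over)

text \<open>The set from \<open>zip_tree_descendants\<close> with the tree eliminated, so that the
  probabilistic argument concerns finitely many ranks only.\<close>

definition rank_descendants :: "('a::linorder \<Rightarrow> 'b::linorder) \<Rightarrow> 'a set \<Rightarrow> 'a \<Rightarrow> 'a set" where
  "rank_descendants rk K x =
    {y \<in> K. (\<forall>z\<in>K. x < z \<and> z \<le> y \<longrightarrow> rk z \<le> rk x) \<and> (\<forall>z\<in>K. y \<le> z \<and> z < x \<longrightarrow> rk z < rk x)}"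

locale geometric_ranks = prob_space M for M :: "'w measure" +
  fixes K :: "'a::linorder set" and R :: "'a \<Rightarrow> 'w \<Rightarrow> nat"
  assumes finite_keys: "finite K"
    and indep_ranks: "indep_vars (\<lambda>_. count_space UNIV) R K"
    and distr_rank: "x \<in> K \<Longrightarrow> distr M (count_space UNIV) (R x) = measure_pmf (geometric_pmf (1/2))"
begin

lemma measurable_rank [measurable]: "x \<in> K \<Longrightarrow> R x \<in> measurable M (count_space UNIV)"
  using indep_ranks by (auto simp: indep_vars_def)

lemma prob_rank_in:
  "x \<in> K \<Longrightarrow> prob (R x -` S \<inter> space M) = measure_pmf.prob (geometric_pmf (1/2)) S"
  by (simp add: measure_distr[OF measurable_rank, symmetric] distr_rank)

lemma prob_rank_less: "x \<in> K \<Longrightarrow> prob (R x -` {..<m} \<inter> space M) = 1 - 1 / 2 ^ m"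
  by (simp add: prob_rank_in prob_geometric_half_lessThan)

lemma prob_rank_eq: "x \<in> K \<Longrightarrow> prob (R x -` {k} \<inter> space M) = 1 / 2 ^ Suc k"
  by (simp add: prob_rank_in measure_pmf_single power_one_over)

lemma prob_rank_ge:
  assumes "x \<in> K"
  shows "prob {\<omega> \<in> space M. m \<le> R x \<omega>} = 1 / 2 ^ m"
proof -
  have "{\<omega> \<in> space M. m \<le> R x \<omega>} = space M - (R x -` {..<m} \<inter> space M)" by auto
  then show ?thesis using assms by (simp add: prob_compl prob_rank_less measurable_sets)
qed

definition desc_event :: "'a \<Rightarrow> 'a \<Rightarrow> 'w set" where
  "desc_event x y = {\<omega> \<in> space M. y \<in> rank_descendants (\<lambda>z. R z \<omega>) K x}"

lemma desc_event_sets [measurable]: "x \<in> K \<Longrightarrow> desc_event x y \<in> events"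
proof -
  assume x: "x \<in> K"
  have cmp: "Measurable.pred M (\<lambda>\<omega>. R z \<omega> \<le> R x \<omega>)" "Measurable.pred M (\<lambda>\<omega>. R z \<omega> < R x \<omega>)"
    if "z \<in> K" for z
  proof -
    \<comment> \<open>Comparisons are measurable for Borel functions, so the discrete ranks are
      composed with the identity into the Borel space.\<close>
    have [measurable]: "R x \<in> borel_measurable M" "R z \<in> borel_measurable M"
      using measurable_rank[OF x] measurable_rank[OF that]
      by (auto intro: measurable_compose[of _ _ _ "\<lambda>i. i"])
    show "Measurable.pred M (\<lambda>\<omega>. R z \<omega> \<le> R x \<omega>)" "Measurable.pred M (\<lambda>\<omega>. R z \<omega> < R x \<omega>)"
      by measurable
  qed
  have "Measurable.pred M (\<lambda>\<omega>. \<forall>z\<in>K. x < z \<and> z \<le> y \<longrightarrow> R z \<omega> \<le> R x \<omega>)"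
    "Measurable.pred M (\<lambda>\<omega>. \<forall>z\<in>K. y \<le> z \<and> z < x \<longrightarrow> R z \<omega> < R x \<omega>)"
    by (intro pred_intros_finite finite_keys pred_intros_imp' cmp; assumption)+
  then show ?thesis unfolding desc_event_def rank_descendants_def by simp
qed

text \<open>Prepares linearity of expectation: the expected count becomes a sum of probabilities
  over \<open>y\<close>.\<close>

lemma card_rank_descendants:
  assumes "\<omega> \<in> space M"
  shows "real (card (rank_descendants (\<lambda>z. R z \<omega>) K x)) = (\<Sum>y\<in>K. indicator (desc_event x y) \<omega>)"
proof -
  have "(\<Sum>y\<in>K. indicator (desc_event x y) \<omega> :: real) =
      (\<Sum>y\<in>K. indicator (rank_descendants (\<lambda>z. R z \<omega>) K x) y)"
    using assms by (intro sum.cong) (auto simp: indicator_def desc_event_def)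
  also have "\<dots> = real (card (K \<inter> rank_descendants (\<lambda>z. R z \<omega>) K x))"
    unfolding real_of_card using finite_keys by (simp add: sum.inter_restrict indicator_def)
  also have "K \<inter> rank_descendants (\<lambda>z. R z \<omega>) K x = rank_descendants (\<lambda>z. R z \<omega>) K x"
    by (auto simp: rank_descendants_def)
  finally show ?thesis ..
qed

text \<open>Once the rank of \<open>x\<close> is fixed to \<open>k\<close>, the comparisons with
  \<open>x\<close> become separate constraints on the ranks of the keys between \<open>x\<close> and
  \<open>y\<close>, and independence yields a product. The leading factor is the probability of rank
  \<open>k\<close>.\<close>

lemma prob_rank_eq_desc_event:
  assumes "x \<in> K" "y \<in> K"
  shows "prob ((R x -` {k} \<inter> space M) \<inter> desc_event x y) =
    1 / 2 ^ Suc k * ((1 - 1 / 2 ^ Suc k) ^ card {z \<in> K. x < z \<and> z \<le> y} *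
                     (1 - 1 / 2 ^ k) ^ card {z \<in> K. y \<le> z \<and> z < x})"
proof -
  let ?A = "{z \<in> K. x < z \<and> z \<le> y}" and ?B = "{z \<in> K. y \<le> z \<and> z < x}"
  let ?J = "insert x (?A \<union> ?B)"
  \<comment> \<open>The admissible ranks of each key: a tie with \<open>k\<close> is allowed above
    \<open>x\<close> but not below, hence \<open>Suc k\<close> against \<open>k\<close>.\<close>
  define S where "S z = (if z = x then {k} else if x < z then {..<Suc k} else {..<k})" for z
  let ?p = "\<lambda>z. prob (R z -` S z \<inter> space M)"
  have SA: "S z = {..<Suc k}" if "z \<in> ?A" for z using that by (auto simp: S_def)
  have SB: "S z = {..<k}" if "z \<in> ?B" for z using that by (auto simp: S_def)
  have Sx: "S x = {k}" by (simp add: S_def)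
  have split: "(\<forall>z\<in>insert x (A \<union> B). P z) \<longleftrightarrow> P x \<and> (\<forall>z\<in>A. P z) \<and> (\<forall>z\<in>B. P z)"
    for A B :: "'a set" and P by blast
  have "R x \<omega> = k \<and> y \<in> rank_descendants (\<lambda>z. R z \<omega>) K x \<longleftrightarrow> (\<forall>z\<in>?J. R z \<omega> \<in> S z)" for \<omega>
  proof -
    have "(\<forall>z\<in>?J. R z \<omega> \<in> S z) \<longleftrightarrow>
        R x \<omega> = k \<and> (\<forall>z\<in>?A. R z \<omega> \<in> S z) \<and> (\<forall>z\<in>?B. R z \<omega> \<in> S z)"
      by (simp only: split Sx singleton_iff)
    also have "\<dots> \<longleftrightarrow> R x \<omega> = k \<and> (\<forall>z\<in>?A. R z \<omega> \<le> k) \<and> (\<forall>z\<in>?B. R z \<omega> < k)"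
      using SA SB by (simp add: less_Suc_eq_le)
    also have "\<dots> \<longleftrightarrow> R x \<omega> = k \<and> y \<in> rank_descendants (\<lambda>z. R z \<omega>) K x"
      using assms(2) unfolding rank_descendants_def by blast
    finally show ?thesis by simp
  qed
  then have "(R x -` {k} \<inter> space M) \<inter> desc_event x y = (\<Inter>z\<in>?J. R z -` S z \<inter> space M)"
    unfolding desc_event_def by blast
  then have "prob ((R x -` {k} \<inter> space M) \<inter> desc_event x y) = prob (\<Inter>z\<in>?J. R z -` S z \<inter> space M)"
    by (rule arg_cong)
  also have "\<dots> = (\<Prod>z\<in>?J. ?p z)"
    \<comment> \<open>The product rule asks for a finite nonempty index set; \<open>x\<close> is
      always in it, even when \<open>y = x\<close>.\<close>
    using indep_ranks by (rule indep_varsD) (use assms finite_keys in auto)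
  also have "\<dots> = ?p x * prod ?p (?A \<union> ?B)"
    using finite_keys by (intro prod.insert) simp_all
  also have "prod ?p (?A \<union> ?B) = prod ?p ?A * prod ?p ?B"
    using finite_keys by (intro prod.union_disjoint) auto
  also have "prod ?p ?A = (1 - 1 / 2 ^ Suc k) ^ card ?A"
    by (simp add: SA prob_rank_less del: power_Suc)
  also have "prod ?p ?B = (1 - 1 / 2 ^ k) ^ card ?B"
    by (simp add: SB prob_rank_less)
  also have "?p x = 1 / 2 ^ Suc k"
    using assms(1) by (simp add: Sx prob_rank_eq)
  finally show ?thesis .
qed

section \<open>Expected number of descendants\<close>

lemma sum_prob_rank_eq_desc_event_le:
  assumes "x \<in> K"
  shows "(\<Sum>y\<in>K. prob ((R x -` {k} \<inter> space M) \<inter> desc_event x y)) \<le> 1 / 2 ^ Suc k * (3 * 2 ^ k - 1)"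
proof -
  have "(\<Sum>y\<in>K. prob ((R x -` {k} \<inter> space M) \<inter> desc_event x y)) =
    1 / 2 ^ Suc k * (\<Sum>y\<in>K. (1 - 1 / 2 ^ Suc k) ^ card {z \<in> K. x < z \<and> z \<le> y} *
                     (1 - 1 / 2 ^ k) ^ card {z \<in> K. y \<le> z \<and> z < x})"
    unfolding sum_distrib_left using assms
    by (intro sum.cong refl prob_rank_eq_desc_event) simp_all
  also have "\<dots> \<le> 1 / 2 ^ Suc k * (3 * 2 ^ k - 1)"
    using assms finite_keys by (intro mult_left_mono sum_descendant_prob_le) simp_all
  finally show ?thesis .
qed

lemma conditional_expectation_le:
  assumes "x \<in> K"
  shows "(\<integral>\<omega>. real (card (rank_descendants (\<lambda>z. R z \<omega>) K x))
           \<partial>(uniform_measure M (R x -` {k} \<inter> space M))) \<le> 3 * 2 ^ k - 1"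
proof -
  let ?E = "R x -` {k} \<inter> space M"
  let ?U = "uniform_measure M ?E"
  have E: "?E \<in> events" using assms by (simp add: measurable_sets)
  have pE: "prob ?E = 1 / 2 ^ Suc k" using assms by (rule prob_rank_eq)
  then have E0: "emeasure M ?E \<noteq> 0" by (simp add: emeasure_eq_measure)
  interpret U: prob_space ?U
    using E0 by (rule prob_space_uniform_measure) simp
  have D: "desc_event x y \<in> events" for y using assms by (rule desc_event_sets)
  have "(\<integral>\<omega>. real (card (rank_descendants (\<lambda>z. R z \<omega>) K x)) \<partial>?U) =
      (\<integral>\<omega>. (\<Sum>y\<in>K. indicator (desc_event x y) \<omega>) \<partial>?U)"
    by (intro Bochner_Integration.integral_cong) (simp_all add: card_rank_descendants)
  also have "\<dots> = (\<Sum>y\<in>K. measure ?U (desc_event x y))"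
    using D sets.sets_into_space[OF D]
    by (simp add: Bochner_Integration.integral_sum U.emeasure_eq_measure Int_absorb2)
  also have "\<dots> = (\<Sum>y\<in>K. prob (?E \<inter> desc_event x y) / prob ?E)"
    using assms E0 by (intro sum.cong refl measure_uniform_measure desc_event_sets) simp_all
  \<comment> \<open>Dividing by the probability of rank \<open>k\<close> cancels the factor
    1/2^(k+1) of the joint bound.\<close>
  also have "\<dots> = 2 ^ Suc k * (\<Sum>y\<in>K. prob (?E \<inter> desc_event x y))"
    by (simp add: pE sum_distrib_left mult.commute)
  also have "\<dots> \<le> 2 ^ Suc k * (1 / 2 ^ Suc k * (3 * 2 ^ k - 1))"
    using assms by (intro mult_left_mono sum_prob_rank_eq_desc_event_le) simp_all
  finally show ?thesis by simp
qed

text \<open>Ranks below the free cutoff \<open>m\<close> are summed by their joint bounds. From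
  \<open>m\<close> on, the number of descendants is bounded trivially by \<open>card K\<close>,
  weighted with the tail probability 1/2^m.\<close>

lemma expectation_le_truncated:
  assumes "x \<in> K"
  shows "expectation (\<lambda>\<omega>. real (card (rank_descendants (\<lambda>z. R z \<omega>) K x))) \<le>
    (\<Sum>k<m. 1 / 2 ^ Suc k * (3 * 2 ^ k - 1)) + real (card K) / 2 ^ m"
proof -
  let ?E = "\<lambda>k. R x -` {k} \<inter> space M" and ?G = "{\<omega> \<in> space M. m \<le> R x \<omega>}"
  have E [measurable]: "?E k \<in> events" for k using assms by (simp add: measurable_sets)
  have G [measurable]: "?G \<in> events" using assms by measurable
  have D [measurable]: "desc_event x y \<in> events" for y using assms by (rule desc_event_sets)
  \<comment> \<open>A pointwise majorant of the number of descendants: if the rank of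
    \<open>x\<close> is at least \<open>m\<close>, the last term alone suffices; otherwise the
    summand with \<open>k = R x \<omega>\<close> does.\<close>
  define g :: "'w \<Rightarrow> real" where
    "g \<omega> = (\<Sum>k<m. \<Sum>y\<in>K. indicator (?E k \<inter> desc_event x y) \<omega>) + real (card K) * indicator ?G \<omega>" for \<omega>
  have int: "integrable M (indicator A :: 'w \<Rightarrow> real)" if "A \<in> events" for A
    using that by (simp add: emeasure_eq_measure)
  have int_g: "integrable M g"
    unfolding g_def by (intro Bochner_Integration.integrable_add Bochner_Integration.integrable_sum
        integrable_mult_right int) auto
  have int_card: "integrable M (\<lambda>\<omega>. real (card (rank_descendants (\<lambda>z. R z \<omega>) K x)))"
    by (subst Bochner_Integration.integrable_cong[OF refl card_rank_descendants])
      (simp_all add: int)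
  have "(\<Sum>y\<in>K. indicator (desc_event x y) \<omega>) \<le> g \<omega>" if \<omega>: "\<omega> \<in> space M" for \<omega>
  proof (cases "m \<le> R x \<omega>")
    case True
    have "(\<Sum>y\<in>K. indicator (desc_event x y) \<omega>) \<le> (\<Sum>y\<in>K. 1 :: real)"
      by (intro sum_mono) (simp add: indicator_def)
    also have "\<dots> \<le> g \<omega>"
      using True \<omega> unfolding g_def by (simp add: sum_nonneg)
    finally show ?thesis .
  next
    case False
    have "(\<Sum>y\<in>K. indicator (desc_event x y) \<omega> :: real) =
        (\<Sum>y\<in>K. indicator (?E (R x \<omega>) \<inter> desc_event x y) \<omega>)"
      using \<omega> by (simp add: indicator_def)
    also have "\<dots> \<le> (\<Sum>k<m. \<Sum>y\<in>K. indicator (?E k \<inter> desc_event x y) \<omega>)"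
      using False by (intro member_le_sum) (simp_all add: sum_nonneg)
    also have "\<dots> \<le> g \<omega>" by (simp add: g_def)
    finally show ?thesis .
  qed
  then have "expectation (\<lambda>\<omega>. real (card (rank_descendants (\<lambda>z. R z \<omega>) K x))) \<le> expectation g"
    using card_rank_descendants[of _ x]
    by (intro integral_mono int_g) (simp_all add: int_card)
  also have "expectation g =
      (\<Sum>k<m. \<Sum>y\<in>K. prob (?E k \<inter> desc_event x y)) + real (card K) * prob ?G"
    unfolding g_def using E G D
    by (simp add: Bochner_Integration.integral_add Bochner_Integration.integral_sum
        Bochner_Integration.integrable_sum int sets.Int)
  also have "\<dots> \<le> (\<Sum>k<m. 1 / 2 ^ Suc k * (3 * 2 ^ k - 1)) + real (card K) * prob ?G"
    using assms by (intro add_right_mono sum_mono sum_prob_rank_eq_desc_event_le)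
  also have "prob ?G = 1 / 2 ^ m" using assms by (rule prob_rank_ge)
  finally show ?thesis by simp
qed

lemma expectation_le:
  assumes "x \<in> K" "card K > 1"
  shows "expectation (\<lambda>\<omega>. real (card (rank_descendants (\<lambda>z. R z \<omega>) K x))) \<le>
    3 / 2 * log 2 (real (card K)) + 3"
proof -
  let ?n = "real (card K)"
  \<comment> \<open>The least integer cutoff that makes the tail term n/2^m at most 1. As the
    logarithm is positive, \<open>nat\<close> does not truncate.\<close>
  define m where "m = nat \<lceil>log 2 ?n\<rceil>"
  have "log 2 ?n > 0" using assms(2) by simp
  then have m: "log 2 ?n \<le> real m" "real m \<le> log 2 ?n + 1" unfolding m_def by linarith+
  have "?n = 2 powr (log 2 ?n)" using assms(2) by simp
  also have "\<dots> \<le> 2 powr real m" using m(1) by simp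
  finally have "?n / 2 ^ m \<le> 1" by (simp add: powr_realpow)
  \<comment> \<open>Each summand is 3/2 - 1/2^(k+1). Since m \<le> lg n + 1, the additive constant
    is at most 3/2 - 1 + 1 + 1 = 5/2, where the last two terms bound 1/2^m and n/2^m.\<close>
  moreover have "(\<Sum>k<m. 1 / 2 ^ Suc k * (3 * 2 ^ k - 1)) = 3 / 2 * real m - (1 - 1 / 2 ^ m)"
  proof (induction m)
    case (Suc m)
    have "1 / 2 ^ Suc m * (3 * 2 ^ m - 1) = (3 / 2 - 1 / 2 ^ Suc m :: real)"
      by (simp add: field_simps)
    moreover have "1 / 2 ^ m = 2 * (1 / 2 ^ Suc m :: real)" by simp
    ultimately show ?case
      using Suc unfolding sum.lessThan_Suc of_nat_Suc by (simp only: algebra_simps)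
  qed simp
  moreover have "1 / 2 ^ m \<le> (1 :: real)" by simp
  ultimately show ?thesis
    using expectation_le_truncated[OF assms(1), of m] m(2) by linarith
qed

end

section \<open>Transfer from ranks to random zip trees\<close>

theorem theorem6:
  fixes M :: "'w measure"
    and K :: "'a::linorder set"
    and n :: nat
    and R :: "'a \<Rightarrow> 'w \<Rightarrow> nat"
    and T :: "'w \<Rightarrow> 'a tree"
  assumes "prob_space M"
    and "n > 1"
    and "finite K" and "card K = n"
    and "prob_space.indep_vars M (\<lambda>_. count_space UNIV) R K"
    and "\<And>x. x \<in> K \<Longrightarrow> distr M (count_space UNIV) (R x) = measure_pmf (geometric_pmf (1/2))"
    and "\<And>\<omega>. \<omega> \<in> space M \<Longrightarrow> zip_tree (\<lambda>x. R x \<omega>) (T \<omega>)"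
    and "\<And>\<omega>. \<omega> \<in> space M \<Longrightarrow> set_tree (T \<omega>) = K"
  shows "(\<forall>x\<in>K. \<forall>k.
            (\<integral>\<omega>. real (card (descendants (T \<omega>) x))
               \<partial>(uniform_measure M {\<omega> \<in> space M. R x \<omega> = k}))
            \<le> 3 * 2 ^ k - 1) \<and>
         (\<forall>x\<in>K. (\<integral>\<omega>. real (card (descendants (T \<omega>) x)) \<partial>M) \<le> 3 / 2 * log 2 (real n) + 3)"
proof -
  interpret geometric_ranks M K R
    using assms by (simp add: geometric_ranks_def geometric_ranks_axioms_def)
  \<comment> \<open>The identity holds at every sample point, and \<open>uniform_measure\<close>
    keeps the sample space, so both integrals can be rewritten pointwise.\<close>
  have desc: "descendants (T \<omega>) x = rank_descendants (\<lambda>z. R z \<omega>) K x"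
    if "\<omega> \<in> space M" "x \<in> K" for \<omega> x
    using zip_tree_descendants[OF assms(7)[OF that(1)], of x] that assms(8)[OF that(1)]
    unfolding rank_descendants_def by simp
  have "(\<integral>\<omega>. real (card (descendants (T \<omega>) x)) \<partial>(uniform_measure M {\<omega> \<in> space M. R x \<omega> = k}))
      \<le> 3 * 2 ^ k - 1" if "x \<in> K" for x k
  proof -
    have "{\<omega> \<in> space M. R x \<omega> = k} = R x -` {k} \<inter> space M" by auto
    then have "(\<integral>\<omega>. real (card (descendants (T \<omega>) x)) \<partial>(uniform_measure M {\<omega> \<in> space M. R x \<omega> = k})) =
        (\<integral>\<omega>. real (card (rank_descendants (\<lambda>z. R z \<omega>) K x))
           \<partial>(uniform_measure M (R x -` {k} \<inter> space M)))"
      using that by (intro Bochner_Integration.integral_cong) (simp_all add: desc)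
    then show ?thesis using conditional_expectation_le[OF that, of k] by simp
  qed
  moreover have "(\<integral>\<omega>. real (card (descendants (T \<omega>) x)) \<partial>M) \<le> 3 / 2 * log 2 (real n) + 3"
    if "x \<in> K" for x
  proof -
    have "(\<integral>\<omega>. real (card (descendants (T \<omega>) x)) \<partial>M) =
        expectation (\<lambda>\<omega>. real (card (rank_descendants (\<lambda>z. R z \<omega>) K x)))"
      using that by (intro Bochner_Integration.integral_cong) (simp_all add: desc)
    then show ?thesis using expectation_le[OF that] assms(2,4) by simp
  qed
  ultimately show ?thesis by blast
qed

end
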